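(* Let $\mathrm{A}^{(1)},\dots,\mathrm{A}^{(g)}$ be deterministic scheduling algorithms having computable delays. Consider the algorithm that: samples $m$ pairs $(u_k,v_k)_{k=1}^m$, each uniformly at random among pairs of distinct jobs; runs the jobs in $\{u_k,v_k\}_{k=1}^m$ until completion in any order; computes, for each $h\in[g]$, $a(h)=\sum_{k=1}^m\big(d^{(h)}(u_k,v_k)+d^{(h)}(v_k,u_k)\big)$; lets $\hat h=\arg\min_h a(h)$; and schedules the remaining jobs using $\mathrm{A}^{(\hat h)}$. With $m=\frac18 n^{2/3}(\log g)^{1/3}$, this algorithm satisfies \[\mathbb{E}[\mathrm{ALG}]\le \min_{h\in[g]}\mathrm{A}^{(h)}+\frac94\, n^{5/3}(\log g)^{1/3}\max_{i\in[n]}p_i.\]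
   Context: Single-machine preemptive scheduling of $n$ jobs available at time $0$ with processing times $p_j>0$, minimizing total completion time; capacity can be shared arbitrarily among unfinished jobs. For a schedule, the delay that job $i$ incurs to job $j$ is $d(i,j)=e_i(C_j)$, the processing received by $i$ before $j$ completes. For an algorithm $\mathrm{A}^{(h)}$, $d^{(h)}(i,j)$ denotes this delay in the schedule produced by $\mathrm{A}^{(h)}$ on the instance, and $\mathrm{A}^{(h)}$ also denotes its total completion time on the instance. $\mathrm{A}^{(h)}$ has computable delays if $d^{(h)}(i,j)$ can be determined once both jobs $i$ and $j$ have been completed (using the information revealed about them, e.g. $p_i,p_j$ and any side information about $i,j$). The algorithms may use arbitrary (possibly different) kinds of predictions or none. *)

theory Defs
  imports "HOL-Probability.Probability"
begin

text \<open>
  A schedule is given by its cumulative processing functions: \<open>e j t\<close> is the amount of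
  processing that job \<open>j\<close> has received by time \<open>t\<close>. Only times \<open>t \<ge> 0\<close> matter.
\<close>

type_synonym 'a schedule = "'a \<Rightarrow> real \<Rightarrow> real"

text \<open>
  The last condition says that the unit capacity of the machine is fully used, and shared
  arbitrarily, as long as some job is unfinished. Together with monotonicity it bounds the
  processing done in any time interval by the length of that interval.
\<close>

definition valid_schedule :: "'a set \<Rightarrow> ('a \<Rightarrow> real) \<Rightarrow> 'a schedule \<Rightarrow> bool" where
  "valid_schedule J p e \<longleftrightarrow>
     (\<forall>j\<in>J. e j 0 = 0 \<and> mono_on {0..} (e j) \<and> (\<forall>t\<ge>0. e j t \<le> p j)) \<and>
     (\<forall>t\<ge>0. (\<Sum>j\<in>J. e j t) = min t (\<Sum>j\<in>J. p j))"

definition completion :: "('a \<Rightarrow> real) \<Rightarrow> 'a schedule \<Rightarrow> 'a \<Rightarrow> real" where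
  "completion p e j = Inf {t. 0 \<le> t \<and> p j \<le> e j t}"

definition total_completion :: "'a set \<Rightarrow> ('a \<Rightarrow> real) \<Rightarrow> 'a schedule \<Rightarrow> real" where
  "total_completion J p e = (\<Sum>j\<in>J. completion p e j)"

text \<open>The delay that job \<open>i\<close> incurs to job \<open>j\<close>.\<close>

definition delay :: "('a \<Rightarrow> real) \<Rightarrow> 'a schedule \<Rightarrow> 'a \<Rightarrow> 'a \<Rightarrow> real" where
  "delay p e i j = e i (completion p e j)"

text \<open>
  An instance consists of a finite set \<open>J\<close> of jobs, processing times \<open>p\<close>, and side information
  \<open>s\<close> (such as predictions) about each job. A deterministic algorithm maps each
  instance to a schedule.
\<close>

type_synonym ('a, 'b) algorithm = "'a set \<Rightarrow> ('a \<Rightarrow> real) \<Rightarrow> ('a \<Rightarrow> 'b) \<Rightarrow> 'a schedule"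

definition scheduling_algorithm :: "('a, 'b) algorithm \<Rightarrow> bool" where
  "scheduling_algorithm A \<longleftrightarrow>
     (\<forall>J p s. finite J \<and> (\<forall>j\<in>J. p j > 0) \<longrightarrow> valid_schedule J p (A J p s))"

text \<open>
  The delay between two jobs is a function of the two jobs and of what is known about these
  two jobs once they are completed; it does not depend on the rest of the instance.
\<close>

definition computable_delays :: "('a, 'b) algorithm \<Rightarrow> bool" where
  "computable_delays A \<longleftrightarrow>
     (\<exists>\<delta>. \<forall>J p s. finite J \<and> (\<forall>j\<in>J. p j > 0) \<longrightarrow>
        (\<forall>i\<in>J. \<forall>j\<in>J. delay p (A J p s) i j = \<delta> i j (p i) (p j) (s i) (s j)))"

text \<open>Run the listed jobs one after another until completion, then follow \<open>e\<close>.\<close>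

primrec run_first :: "('a \<Rightarrow> real) \<Rightarrow> 'a list \<Rightarrow> 'a schedule \<Rightarrow> 'a schedule" where
  "run_first p [] e = e"
| "run_first p (x # xs) e =
     (\<lambda>j t. if j = x then min t (p x)
            else if t < p x then 0
            else run_first p xs e j (t - p x))"

definition distinct_pairs :: "'a set \<Rightarrow> ('a \<times> 'a) set" where
  "distinct_pairs J = {(u, v). u \<in> J \<and> v \<in> J \<and> u \<noteq> v}"

definition sample_pairs :: "nat \<Rightarrow> 'a set \<Rightarrow> ('a \<times> 'a) list pmf" where
  "sample_pairs m J = replicate_pmf m (pmf_of_set (distinct_pairs J))"

definition sampled_jobs :: "('a \<times> 'a) list \<Rightarrow> 'a set" where
  "sampled_jobs ps = fst ` set ps \<union> snd ` set ps"

text \<open>The quantity \<open>a(h)\<close> for the algorithm \<open>A\<close> and the sampled pairs \<open>ps\<close>.\<close>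

definition sampled_delay ::
  "('a, 'b) algorithm \<Rightarrow> 'a set \<Rightarrow> ('a \<Rightarrow> real) \<Rightarrow> ('a \<Rightarrow> 'b) \<Rightarrow> ('a \<times> 'a) list \<Rightarrow> real" where
  "sampled_delay A J p s ps =
     (\<Sum>(u, v)\<leftarrow>ps. delay p (A J p s) u v + delay p (A J p s) v u)"

text \<open>
  The schedule for the sample \<open>ps\<close>: \<open>seq\<close> is the order in which the sampled jobs are run and
  \<open>A\<close> is the algorithm used for the remaining jobs.
\<close>

definition sample_then_run ::
  "('a, 'b) algorithm \<Rightarrow> 'a set \<Rightarrow> ('a \<Rightarrow> real) \<Rightarrow> ('a \<Rightarrow> 'b) \<Rightarrow> ('a \<times> 'a) list \<Rightarrow> 'a list
     \<Rightarrow> 'a schedule" where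
  "sample_then_run A J p s ps seq = run_first p seq (A (J - sampled_jobs ps) p s)"

end

theory Submission
  imports Defs
begin

text \<open>
  The total completion time is the sum of the processing times and of the mutual delays
  \<open>D u v = d(u, v) + d(v, u)\<close> over all pairs of jobs, where \<open>D u v\<close> lies between
  \<open>min (p u) (p v)\<close> and \<open>p u + p v\<close>. Hence selecting an algorithm by sampled delays is empirical
  risk minimization with losses in an interval of length \<open>P = Max p\<close>, and Hoeffding's lemma
  bounds the expected loss of the selection by \<open>ln g / (m t) + t P\<^sup>2 / 8\<close> per pair, for every
  \<open>t > 0\<close>. Running the sampled jobs first costs at most \<open>2 m n P\<close>, since computable delays make
  the chosen algorithm delay the remaining jobs on their own exactly as on the full instance.

  Rounding the sample size is harmless when \<open>n\<close> is large compared to \<open>ln g\<close>. Otherwise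
  the bound holds because any two schedules differ by at most \<open>P\<close> on each of the \<open>n (n - 1) / 2\<close> pairs.
\<close>

subsection \<open>Expected loss of empirical minimization\<close>

text \<open>Finite support makes every real function integrable, which settles the integrability
  conditions for the sample distribution.\<close>

lemma finite_set_replicate_pmf:
  assumes "finite (set_pmf q)"
  shows "finite (set_pmf (replicate_pmf m q))"
  using assms finite_lists_length_eq[of "set_pmf q" m]
  by (simp add: set_replicate_pmf lists_eq_set)

text \<open>The entries of the sample are independent and identically distributed; with exponential
  factors this gives the moment generating function of a sample sum.\<close>

lemma expectation_prod_list_replicate_pmf:
  fixes f :: "'a \<Rightarrow> real"
  assumes "finite (set_pmf q)"
  shows "measure_pmf.expectation (replicate_pmf m q) (\<lambda>xs. prod_list (map f xs))
         = measure_pmf.expectation q f ^ m"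
proof (induction m)
  case 0
  then show ?case by simp
next
  case (Suc m)
  have "finite (set_pmf (replicate_pmf m q))"
    by (rule finite_set_replicate_pmf[OF assms])
  with Suc assms show ?case
    by (simp add: pmf_expectation_bind[of "set_pmf q"] integral_measure_pmf[of "set_pmf q" q]
        sum_distrib_right mult.assoc flip: map_pmf_def)
qed

lemma expectation_sum_list_replicate_pmf:
  fixes f :: "'a \<Rightarrow> real"
  assumes "finite (set_pmf q)"
  shows "measure_pmf.expectation (replicate_pmf m q) (\<lambda>xs. sum_list (map f xs))
         = m * measure_pmf.expectation q f"
proof (induction m)
  case 0
  then show ?case by simp
next
  case (Suc m)
  have fin: "finite (set_pmf (replicate_pmf m q))"
    by (rule finite_set_replicate_pmf[OF assms])
  have "(\<Sum>x\<in>set_pmf q. pmf q x) = 1"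
    using assms by (simp add: sum_pmf_eq_1)
  with Suc assms fin show ?case
    by (simp add: pmf_expectation_bind[of "set_pmf q"] integral_measure_pmf[of "set_pmf q" q]
       integrable_measure_pmf_finite sum.distrib distrib_left distrib_right
      flip: map_pmf_def sum_distrib_left sum_distrib_right)
qed

text \<open>Finite support turns the \<open>nn_integral\<close> form of Hoeffding's lemma into one
  about real expectations.\<close>

lemma Hoeffdings_lemma_pmf:
  fixes f :: "'a \<Rightarrow> real"
  assumes "finite (set_pmf q)" and "\<And>x. x \<in> set_pmf q \<Longrightarrow> a \<le> f x \<and> f x \<le> b" and "t > 0"
  shows "measure_pmf.expectation q (\<lambda>x. exp (t * (f x - measure_pmf.expectation q f)))
         \<le> exp (t\<^sup>2 * (b - a)\<^sup>2 / 8)"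
proof -
  interpret interval_bounded_random_variable "measure_pmf q" f a b
    by unfold_locales (use assms(2) in \<open>auto simp: AE_measure_pmf_iff\<close>)
  have "ennreal (measure_pmf.expectation q (\<lambda>x. exp (t * (f x - measure_pmf.expectation q f))))
      = (\<integral>\<^sup>+ x. exp (t * (f x - measure_pmf.expectation q f)) \<partial>measure_pmf q)"
    using assms(1) by (intro nn_integral_eq_integral[symmetric] integrable_measure_pmf_finite) auto
  also have "\<dots> \<le> ennreal (exp (t\<^sup>2 * (b - a)\<^sup>2 / 8))"
    using Hoeffdings_lemma_nn_integral[OF \<open>t > 0\<close>] by simp
  finally show ?thesis by (simp add: ennreal_le_iff)
qed

lemma expectation_pmf_mono:
  fixes f g :: "'a \<Rightarrow> real"
  assumes "finite (set_pmf q)" and "\<And>x. x \<in> set_pmf q \<Longrightarrow> f x \<le> g x"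
  shows "measure_pmf.expectation q f \<le> measure_pmf.expectation q g"
  using assms by (intro integral_mono_AE) (auto simp: AE_measure_pmf_iff integrable_measure_pmf_finite)

text \<open>A maximal inequality: \<open>sel\<close> may depend on \<open>x\<close>, but the
  exponential of the selected value is at most the sum of the exponentials over all of
  \<open>H\<close>. After taking logarithms this costs only \<open>ln (card H)\<close>.\<close>

lemma expectation_selected_le:
  fixes Z :: "'h \<Rightarrow> 'x \<Rightarrow> real"
  assumes fin: "finite (set_pmf q)" and "finite H" and "t > 0"
    and sel: "\<And>x. x \<in> set_pmf q \<Longrightarrow> sel x \<in> H"
    and mgf: "\<And>h. h \<in> H \<Longrightarrow> measure_pmf.expectation q (\<lambda>x. exp (t * Z h x)) \<le> exp c"
  shows "measure_pmf.expectation q (\<lambda>x. Z (sel x) x) \<le> (ln (card H) + c) / t"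
proof -
  note [simp] = integrable_measure_pmf_finite[OF fin]
  define E where "E = measure_pmf.expectation q (\<lambda>x. Z (sel x) x)"
  obtain x0 where "x0 \<in> set_pmf q" using set_pmf_not_empty by fast
  then have H: "card H > 0" using sel \<open>finite H\<close> by (auto simp: card_gt_0_iff)
  \<comment> \<open>Jensen's inequality for the exponential, in its tangent line form.\<close>
  have "exp (t * E) = measure_pmf.expectation q (\<lambda>x. exp (t * E) * (1 + t * (Z (sel x) x - E)))"
    by (simp add: E_def)
  also have "\<dots> \<le> measure_pmf.expectation q (\<lambda>x. \<Sum>h\<in>H. exp (t * Z h x))"
  proof (rule expectation_pmf_mono[OF fin])
    fix x assume x: "x \<in> set_pmf q"
    have "exp (t * E) * (1 + t * (Z (sel x) x - E)) \<le> exp (t * E) * exp (t * (Z (sel x) x - E))"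
      by (intro mult_left_mono exp_ge_add_one_self) auto
    also have "\<dots> = exp (t * Z (sel x) x)"
      by (simp add: algebra_simps flip: exp_add)
    also have "\<dots> \<le> (\<Sum>h\<in>H. exp (t * Z h x))"
      using sel[OF x] \<open>finite H\<close> by (intro member_le_sum) auto
    finally show "exp (t * E) * (1 + t * (Z (sel x) x - E)) \<le> (\<Sum>h\<in>H. exp (t * Z h x))" .
  qed
  also have "\<dots> \<le> card H * exp c"
    using mgf by (auto intro!: sum_bounded_above)
  finally have "t * E \<le> ln (card H * exp c)"
    using H by (subst ln_ge_iff) auto
  also have "\<dots> = ln (card H) + c"
    using H by (simp add: ln_mult)
  finally show ?thesis
    using \<open>t > 0\<close> by (simp add: E_def field_simps)
qed

text \<open>The reference \<open>h0\<close> is fixed, so its sample sum has the right mean; only the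
  deviation of the data-dependent index \<open>sel xs\<close> has to be controlled.\<close>

lemma expectation_empirical_minimizer:
  fixes f :: "'h \<Rightarrow> 'x \<Rightarrow> real"
  assumes fin: "finite (set_pmf q)" and "finite H" and "t > 0" and "m > 0"
    and f: "\<And>h x. h \<in> H \<Longrightarrow> x \<in> set_pmf q \<Longrightarrow> 0 \<le> f h x \<and> f h x \<le> b"
    and sel: "\<And>xs. xs \<in> set_pmf (replicate_pmf m q) \<Longrightarrow> sel xs \<in> H"
    and le: "\<And>xs. xs \<in> set_pmf (replicate_pmf m q) \<Longrightarrow>
      sum_list (map (f (sel xs)) xs) \<le> sum_list (map (f h0) xs)"
  shows "measure_pmf.expectation (replicate_pmf m q) (\<lambda>xs. measure_pmf.expectation q (f (sel xs)))
    \<le> measure_pmf.expectation q (f h0) + ln (card H) / (m * t) + t * b\<^sup>2 / 8"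
proof -
  define \<mu> where "\<mu> h = measure_pmf.expectation q (f h)" for h
  \<comment> \<open>\<open>Z h\<close> is positive when the sample underestimates the loss of
    \<open>h\<close>, the direction in which a minimizer is misled.\<close>
  define Z where "Z h xs = m * \<mu> h - sum_list (map (f h) xs)" for h xs
  let ?Q = "replicate_pmf m q"
  have finQ: "finite (set_pmf ?Q)"
    by (rule finite_set_replicate_pmf[OF fin])
  note [simp] = integrable_measure_pmf_finite[OF finQ]
  have mgf: "measure_pmf.expectation ?Q (\<lambda>xs. exp (t * Z h xs)) \<le> exp (m * (t\<^sup>2 * b\<^sup>2 / 8))"
    if "h \<in> H" for h
  proof -
    have *: "exp (t * Z h xs) = prod_list (map (\<lambda>x. exp (t * (- f h x - (- \<mu> h)))) xs)"
      if "length xs = m" for xs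
    proof -
      have "t * Z h xs = (\<Sum>x\<leftarrow>xs. t * (- f h x - (- \<mu> h)))"
        using that unfolding Z_def by (induction xs arbitrary: m) (auto simp: algebra_simps)
      moreover have "exp (sum_list (map g xs)) = prod_list (map (\<lambda>x. exp (g x)) xs)" for g :: "_ \<Rightarrow> real"
        by (induction xs) (simp_all add: exp_add)
      ultimately show ?thesis by simp
    qed
    have "measure_pmf.expectation ?Q (\<lambda>xs. exp (t * Z h xs))
      = measure_pmf.expectation ?Q (\<lambda>xs. prod_list (map (\<lambda>x. exp (t * (- f h x - (- \<mu> h)))) xs))"
      by (intro integral_cong_AE) (auto simp: AE_measure_pmf_iff set_replicate_pmf *)
    also have "\<dots> = measure_pmf.expectation q (\<lambda>x. exp (t * (- f h x - (- \<mu> h)))) ^ m"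
      using fin by (rule expectation_prod_list_replicate_pmf)
    \<comment> \<open>Hoeffding's lemma is applied to \<open>- f h\<close>, with values between
      \<open>- b\<close> and 0, because \<open>Z\<close> measures deviations below the mean.\<close>
    also have "\<dots> \<le> exp (t\<^sup>2 * (0 - (- b))\<^sup>2 / 8) ^ m"
      using Hoeffdings_lemma_pmf[OF fin, of "- b" "\<lambda>x. - f h x" 0 t] f[OF that] \<open>t > 0\<close>
      by (intro power_mono) (auto simp: \<mu>_def)
    also have "\<dots> = exp (m * (t\<^sup>2 * b\<^sup>2 / 8))"
      by (simp flip: exp_of_nat_mult)
    finally show ?thesis .
  qed
  have "m * measure_pmf.expectation ?Q (\<lambda>xs. \<mu> (sel xs))
    = measure_pmf.expectation ?Q (\<lambda>xs. m * \<mu> (sel xs))"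
    by simp
  \<comment> \<open>Minimality trades the sample sum of \<open>sel xs\<close> for that of
    \<open>h0\<close>.\<close>
  also have "\<dots> \<le> measure_pmf.expectation ?Q (\<lambda>xs. Z (sel xs) xs + sum_list (map (f h0) xs))"
    using le by (intro expectation_pmf_mono[OF finQ]) (auto simp: Z_def)
  also have "\<dots> = measure_pmf.expectation ?Q (\<lambda>xs. Z (sel xs) xs) + m * \<mu> h0"
    using fin by (simp add: expectation_sum_list_replicate_pmf \<mu>_def)
  also have "\<dots> \<le> (ln (card H) + m * (t\<^sup>2 * b\<^sup>2 / 8)) / t + m * \<mu> h0"
    using expectation_selected_le[OF finQ \<open>finite H\<close> \<open>t > 0\<close> sel mgf] by simp
  also have "\<dots> = m * (\<mu> h0 + ln (card H) / (m * t) + t * b\<^sup>2 / 8)"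
    using \<open>t > 0\<close> \<open>m > 0\<close> by (simp add: field_simps power2_eq_square)
  finally show ?thesis
    using \<open>m > 0\<close> by (simp add: \<mu>_def)
qed

subsection \<open>Schedules and delays\<close>

lemma completion_eqI:
  assumes "0 \<le> C" and "\<And>t. 0 \<le> t \<Longrightarrow> p j \<le> e j t \<longleftrightarrow> C \<le> t"
  shows "completion p e j = C"
proof -
  have "{t. 0 \<le> t \<and> p j \<le> e j t} = {C..}"
    using assms by (auto intro: order_trans)
  then show ?thesis by (simp add: completion_def)
qed

text \<open>The processing of the other jobs never decreases, so the progress of one job is at most
  that of all jobs together.\<close>

lemma valid_schedule_lipschitz:
  assumes fin: "finite J" and v: "valid_schedule J p e" and "j \<in> J" and "0 \<le> r" "r \<le> t"
  shows "e j t - e j r \<le> t - r"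
proof -
  have "e j t - e j r \<le> (\<Sum>i\<in>J. e i t - e i r)"
    using v assms(3-5) fin
    by (intro member_le_sum) (auto simp: valid_schedule_def mono_on_def)
  also have "\<dots> = min t (sum p J) - min r (sum p J)"
    using v assms(4,5) by (simp add: valid_schedule_def sum_subtractf)
  also have "\<dots> \<le> t - r" using assms(5) by auto
  finally show ?thesis .
qed

lemma valid_schedule_end:
  assumes fin: "finite J" and v: "valid_schedule J p e" and "j \<in> J" and "sum p J \<le> t" "0 \<le> t"
  shows "e j t = p j"
proof -
  have le: "e i t \<le> p i" if "i \<in> J" for i
    using v that assms(5) by (simp add: valid_schedule_def)
  have "(\<Sum>i\<in>J. p i - e i t) = 0"
    using v assms(4,5) by (simp add: valid_schedule_def sum_subtractf)
  then have "p j - e j t = 0"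
    using fin le \<open>j \<in> J\<close> by (subst (asm) sum_nonneg_eq_0_iff) auto
  then show ?thesis by simp
qed

lemma valid_schedule_sum_nonneg:
  assumes "valid_schedule J p e"
  shows "0 \<le> sum p J"
proof (rule sum_nonneg)
  fix j assume "j \<in> J"
  then have "e j 0 = 0" and "\<forall>t\<ge>0. e j t \<le> p j" using assms by (auto simp: valid_schedule_def)
  then show "0 \<le> p j" by (metis order_refl)
qed

lemma completion_bounds:
  assumes fin: "finite J" and v: "valid_schedule J p e" and j: "j \<in> J"
  shows "0 \<le> completion p e j" and "completion p e j \<le> sum p J"
proof -
  let ?S = "{t. 0 \<le> t \<and> p j \<le> e j t}"
  \<comment> \<open>Nonemptiness of \<open>?S\<close>, without which \<open>Inf\<close> would carry
    no information.\<close>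
  have T: "sum p J \<in> ?S"
    using valid_schedule_end[OF assms order_refl] valid_schedule_sum_nonneg[OF v] by simp
  then show "0 \<le> completion p e j"
    unfolding completion_def by (intro cInf_greatest) auto
  show "completion p e j \<le> sum p J"
    unfolding completion_def using T by (intro cInf_lower bdd_belowI[of _ 0]) auto
qed

text \<open>The infimum defining the completion time is attained, since the Lipschitz bound rules
  out jumps of \<open>e j\<close>.\<close>

lemma completion_le_iff:
  assumes fin: "finite J" and v: "valid_schedule J p e" and j: "j \<in> J" and "0 \<le> t"
  shows "completion p e j \<le> t \<longleftrightarrow> p j \<le> e j t"
proof
  let ?S = "{t. 0 \<le> t \<and> p j \<le> e j t}"
  let ?C = "completion p e j"
  have T: "sum p J \<in> ?S"
    using valid_schedule_end[OF assms(1-3) order_refl] valid_schedule_sum_nonneg[OF v] by simp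
  have lower: "?C \<le> t" if "t \<in> ?S" for t
    unfolding completion_def using that by (intro cInf_lower bdd_belowI[of _ 0]) auto
  then show "p j \<le> e j t \<Longrightarrow> ?C \<le> t" using \<open>0 \<le> t\<close> by auto
  have C0: "0 \<le> ?C" using assms by (intro completion_bounds)
  \<comment> \<open>A job lacking \<open>p j - e j ?C\<close> at time \<open>?C\<close> needs at
    least that much longer; as \<open>?C\<close> is the infimum itself, nothing is lacking.\<close>
  have "?C + (p j - e j ?C) \<le> Inf ?S"
  proof (rule cInf_greatest)
    fix r assume r: "r \<in> ?S"
    have "e j r - e j ?C \<le> r - ?C"
      using valid_schedule_lipschitz[OF fin v j C0] lower[OF r] by simp
    then show "?C + (p j - e j ?C) \<le> r" using r by simp
  qed (use T in auto)
  then have "p j \<le> e j ?C" by (simp add: completion_def)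
  moreover assume "?C \<le> t"
  then have "e j ?C \<le> e j t"
    using v j C0 by (auto simp: valid_schedule_def mono_on_def)
  ultimately show "p j \<le> e j t" by simp
qed

lemma delay_bounds:
  assumes "finite J" and "valid_schedule J p e" and "i \<in> J" and "j \<in> J"
  shows "0 \<le> delay p e i j" and "delay p e i j \<le> p i"
proof -
  have "0 \<le> completion p e j" using assms by (intro completion_bounds)
  moreover have "e i 0 = 0" "mono_on {0..} (e i)" "\<forall>t\<ge>0. e i t \<le> p i"
    using assms by (auto simp: valid_schedule_def)
  ultimately show "0 \<le> delay p e i j" "delay p e i j \<le> p i"
    unfolding delay_def by (auto simp: mono_on_def dest: spec[of _ 0])
qed

lemma delay_eq_processing_time:
  assumes "finite J" and "valid_schedule J p e" and "i \<in> J" and "j \<in> J"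
    and "completion p e i \<le> completion p e j"
  shows "delay p e i j = p i"
  using completion_le_iff[of J p e i "completion p e j"] completion_bounds(1)[of J p e j]
    delay_bounds(2)[OF assms(1-4)] assms by (simp add: delay_def)

text \<open>This is the capacity identity at the time \<open>j\<close> completes: up to then the
  machine is never idle.\<close>

lemma completion_eq_sum_delay:
  assumes "finite J" and "valid_schedule J p e" and "j \<in> J"
  shows "completion p e j = (\<Sum>i\<in>J. delay p e i j)"
proof -
  have "(\<Sum>i\<in>J. e i (completion p e j)) = min (completion p e j) (sum p J)"
    using assms(2) completion_bounds(1)[OF assms] by (simp add: valid_schedule_def)
  then show ?thesis
    using completion_bounds(2)[OF assms] by (simp add: delay_def)
qed

text \<open>The job that completes first delays the other by its full processing time; the opposite
  delay is nonnegative and at most the other processing time.\<close>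

lemma pair_delay_bounds:
  assumes "finite J" and "valid_schedule J p e" and "i \<in> J" and "j \<in> J"
  shows "min (p i) (p j) \<le> delay p e i j + delay p e j i"
    and "delay p e i j + delay p e j i \<le> p i + p j"
proof -
  have "delay p e i j = p i \<or> delay p e j i = p j"
    using delay_eq_processing_time assms by (metis linear)
  then show "min (p i) (p j) \<le> delay p e i j + delay p e j i"
    and "delay p e i j + delay p e j i \<le> p i + p j"
    using delay_bounds[OF assms(1,2,3,4)] delay_bounds[OF assms(1,2,4,3)] by auto
qed

section \<open>Total completion time as a sum over pairs of jobs\<close>

lemma distinct_pairs_eq_Sigma: "distinct_pairs J = Sigma J (\<lambda>u. J - {u})"
  by (auto simp: distinct_pairs_def)

lemma finite_distinct_pairs: "finite J \<Longrightarrow> finite (distinct_pairs J)"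
  by (simp add: distinct_pairs_eq_Sigma)

lemma card_distinct_pairs: "finite J \<Longrightarrow> card (distinct_pairs J) = card J * (card J - 1)"
  by (simp add: distinct_pairs_eq_Sigma)

lemma sum_distinct_pairs_swap:
  "(\<Sum>(u, v)\<in>distinct_pairs J. f v u) = (\<Sum>(u, v)\<in>distinct_pairs J. f u v)"
  by (rule sum.reindex_bij_witness[of _ prod.swap prod.swap]) (auto simp: distinct_pairs_def)

text \<open>The delays of jobs to themselves give \<open>sum p J\<close>. Ordered pairs count every
  mutual delay twice, hence the division by 2.\<close>

lemma total_completion_eq_pair_delays:
  assumes fin: "finite J" and v: "valid_schedule J p e"
  shows "total_completion J p e =
    sum p J + (\<Sum>(u, v)\<in>distinct_pairs J. delay p e u v + delay p e v u) / 2"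
proof -
  have "(\<Sum>(u, v)\<in>distinct_pairs J. delay p e u v + delay p e v u)
      = 2 * (\<Sum>(u, v)\<in>distinct_pairs J. delay p e v u)"
    using sum_distinct_pairs_swap[of "delay p e" J] by (simp add: case_prod_beta sum.distrib)
  moreover have "total_completion J p e = (\<Sum>j\<in>J. p j + (\<Sum>i\<in>J-{j}. delay p e i j))"
    unfolding total_completion_def
  proof (rule sum.cong)
    fix j assume j: "j \<in> J"
    show "completion p e j = p j + (\<Sum>i\<in>J-{j}. delay p e i j)"
      unfolding completion_eq_sum_delay[OF assms j] sum.remove[OF fin j]
        delay_eq_processing_time[OF assms j j order_refl] ..
  qed simp
  ultimately show ?thesis
    using fin by (simp add: distinct_pairs_eq_Sigma sum.distrib sum.Sigma)
qed

text \<open>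
  With \<open>pair_delay_bounds\<close>: on each pair the two schedules differ by at most
  \<open>p u + p v - min (p u) (p v) = max (p u) (p v)\<close>.
\<close>

lemma total_completion_le_other_schedule:
  assumes fin: "finite J" and e: "valid_schedule J p e" and e': "valid_schedule J p e'"
    and P: "\<And>j. j \<in> J \<Longrightarrow> p j \<le> P"
  shows "total_completion J p e
    \<le> total_completion J p e' + real (card (distinct_pairs J)) * P / 2"
proof -
  have "(\<Sum>(u, v)\<in>distinct_pairs J. delay p e u v + delay p e v u)
     \<le> (\<Sum>(u, v)\<in>distinct_pairs J. (delay p e' u v + delay p e' v u) + P)"
  proof (rule sum_mono, clarify)
    fix u v assume "(u, v) \<in> distinct_pairs J"
    then have uv: "u \<in> J" "v \<in> J" by (auto simp: distinct_pairs_def)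
    show "delay p e u v + delay p e v u \<le> (delay p e' u v + delay p e' v u) + P"
      using pair_delay_bounds(2)[OF fin e uv] pair_delay_bounds(1)[OF fin e' uv] P[OF uv(1)] P[OF uv(2)]
      by linarith
  qed
  also have "\<dots> = (\<Sum>(u, v)\<in>distinct_pairs J. delay p e' u v + delay p e' v u)
      + real (card (distinct_pairs J)) * P"
    by (simp add: case_prod_beta sum.distrib)
  finally show ?thesis
    by (simp add: total_completion_eq_pair_delays[OF fin e] total_completion_eq_pair_delays[OF fin e'])
qed

section \<open>Cost of running some jobs first\<close>

lemma valid_run_first:
  assumes "finite K" and "valid_schedule K p e"
    and "distinct seq" and "set seq \<inter> K = {}" and "\<And>j. j \<in> set seq \<Longrightarrow> 0 \<le> p j"
  shows "valid_schedule (set seq \<union> K) p (run_first p seq e)"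
  using assms(3-5)
proof (induction seq)
  case Nil
  then show ?case using assms(2) by simp
next
  case (Cons x xs)
  let ?J = "set xs \<union> K" and ?f = "run_first p xs e" and ?f' = "run_first p (x # xs) e"
  have IH: "valid_schedule ?J p ?f" and x: "x \<notin> ?J" and px: "0 \<le> p x" using Cons by auto
  have fin: "finite ?J" using assms(1) by simp
  have f: "?f j 0 = 0" "\<And>r t. 0 \<le> r \<Longrightarrow> r \<le> t \<Longrightarrow> ?f j r \<le> ?f j t" "\<And>t. t \<ge> 0 \<Longrightarrow> ?f j t \<le> p j"
    if "j \<in> ?J" for j
    using IH that by (auto simp: valid_schedule_def mono_on_def)
  \<comment> \<open>Nonnegativity keeps the shifted copy of \<open>?f\<close> monotone at time
    \<open>p x\<close>, where it takes over from the value 0.\<close>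
  have f0: "0 \<le> ?f j t" "0 \<le> p j" if "j \<in> ?J" "0 \<le> t" for j t
    using f[OF that(1)] that(2) by (metis order_refl order_trans)+
  have "?f' j 0 = 0 \<and> mono_on {0..} (?f' j) \<and> (\<forall>t\<ge>0. ?f' j t \<le> p j)" if "j \<in> insert x ?J" for j
    using that f f0 px x by (cases "j = x") (auto simp: mono_on_def)
  moreover have "(\<Sum>j\<in>insert x ?J. ?f' j t) = min t (sum p (insert x ?J))" if "0 \<le> t" for t
  proof -
    have "(\<Sum>j\<in>?J. ?f' j t) = (\<Sum>j\<in>?J. if t < p x then 0 else ?f j (t - p x))"
      using x by (intro sum.cong) auto
    also have "\<dots> = (if t < p x then 0 else min (t - p x) (sum p ?J))"
      using IH that by (simp add: valid_schedule_def)
    finally show ?thesis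
      using fin x valid_schedule_sum_nonneg[OF IH] by auto
  qed
  ultimately show ?case by (simp add: valid_schedule_def del: run_first.simps)
qed

text \<open>Putting \<open>x\<close> in front shifts every later completion time by
  \<open>p x\<close>, so a listed job costs at most its length times the number of jobs.\<close>

lemma total_completion_run_first_le:
  assumes "finite K" and "valid_schedule K p e"
    and "distinct seq" and "set seq \<inter> K = {}" and "\<And>j. j \<in> set seq \<union> K \<Longrightarrow> 0 < p j"
  shows "total_completion (set seq \<union> K) p (run_first p seq e)
    \<le> total_completion K p e + real (card (set seq \<union> K)) * sum p (set seq)"
  using assms(3-5)
proof (induction seq)
  case Nil
  then show ?case by simp
next
  case (Cons x xs)
  let ?J = "set xs \<union> K" and ?f = "run_first p xs e" and ?f' = "run_first p (x # xs) e"
  have x: "x \<notin> ?J" and px: "0 < p x" using Cons.prems by auto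
  have fin: "finite ?J" using assms(1) by simp
  have v: "valid_schedule ?J p ?f"
    using Cons.prems assms by (intro valid_run_first) (auto intro: less_imp_le)
  have "completion p ?f' x = p x"
    using px by (intro completion_eqI) auto
  moreover have "completion p ?f' j = p x + completion p ?f j" if j: "j \<in> ?J" for j
  proof (rule completion_eqI)
    have C0: "0 \<le> completion p ?f j" using completion_bounds[OF fin v j] by simp
    then show "0 \<le> p x + completion p ?f j" using px by simp
    fix t :: real assume "0 \<le> t"
    \<comment> \<open>Before time \<open>p x\<close> both sides are false: \<open>j\<close> has
      received nothing, while \<open>p j\<close> is positive.\<close>
    show "p j \<le> ?f' j t \<longleftrightarrow> p x + completion p ?f j \<le> t"
      using completion_le_iff[OF fin v j, of "t - p x"] x j C0 Cons.prems(3)[of j]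
      by (auto simp: not_le)
  qed
  ultimately have "total_completion (insert x ?J) p ?f'
      = (real (card ?J) + 1) * p x + total_completion ?J p ?f"
    using fin x by (simp add: total_completion_def sum.distrib algebra_simps del: run_first.simps)
  also have "\<dots> \<le> (real (card ?J) + 1) * p x
      + (total_completion K p e + real (card ?J) * sum p (set xs))"
    using Cons by (intro add_left_mono) auto
  also have "\<dots> \<le> total_completion K p e + (real (card ?J) + 1) * (p x + sum p (set xs))"
    using Cons.prems sum_nonneg[of "set xs" p] by (auto simp: algebra_simps intro: less_imp_le)
  finally show ?case
    using fin x by (simp add: add.commute del: run_first.simps)
qed

text \<open>Computable delays make the delays within \<open>K\<close> the same on both instances, so
  passing to \<open>K\<close> only drops nonnegative terms from the sum of all delays.\<close>

lemma total_completion_computable_delays_mono: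
  assumes A: "scheduling_algorithm A" "computable_delays A" and "finite J"
    and p: "\<And>j. j \<in> J \<Longrightarrow> 0 < p j" and K: "K \<subseteq> J"
  shows "total_completion K p (A K p s) \<le> total_completion J p (A J p s)"
proof -
  have finK: "finite K" using K \<open>finite J\<close> finite_subset by blast
  have vK: "valid_schedule K p (A K p s)" and vJ: "valid_schedule J p (A J p s)"
    using A(1) K p finK \<open>finite J\<close> unfolding scheduling_algorithm_def by blast+
  obtain \<delta> where \<delta>: "\<forall>J p s. finite J \<and> (\<forall>j\<in>J. 0 < p j) \<longrightarrow>
      (\<forall>i\<in>J. \<forall>j\<in>J. delay p (A J p s) i j = \<delta> i j (p i) (p j) (s i) (s j))"
    using A(2) unfolding computable_delays_def ..
  have delay_eq: "delay p (A K p s) i j = delay p (A J p s) i j" if "i \<in> K" "j \<in> K" for i j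
    using \<delta>[rule_format, of K p i j s] \<delta>[rule_format, of J p i j s] finK \<open>finite J\<close> p K that
    by (simp add: subset_iff)
  have "total_completion K p (A K p s) = (\<Sum>j\<in>K. \<Sum>i\<in>K. delay p (A J p s) i j)"
    by (simp add: total_completion_def completion_eq_sum_delay[OF finK vK] delay_eq)
  also have "\<dots> \<le> (\<Sum>j\<in>K. \<Sum>i\<in>J. delay p (A J p s) i j)"
    using K \<open>finite J\<close> delay_bounds(1)[OF \<open>finite J\<close> vJ] by (intro sum_mono sum_mono2) auto
  also have "\<dots> \<le> (\<Sum>j\<in>J. \<Sum>i\<in>J. delay p (A J p s) i j)"
    using K \<open>finite J\<close> delay_bounds(1)[OF \<open>finite J\<close> vJ] by (intro sum_mono2 sum_nonneg) auto
  also have "\<dots> = total_completion J p (A J p s)"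
    by (simp add: total_completion_def completion_eq_sum_delay[OF \<open>finite J\<close> vJ])
  finally show ?thesis .
qed

subsection \<open>Sampling and selection\<close>

lemma sample_then_run_properties:
  assumes A: "scheduling_algorithm A" "computable_delays A" and fin: "finite J"
    and p: "\<And>j. j \<in> J \<Longrightarrow> 0 < p j" and sub: "sampled_jobs ps \<subseteq> J"
    and seq: "distinct seq" "set seq = sampled_jobs ps"
  shows "valid_schedule J p (sample_then_run A J p s ps seq)"
    and "total_completion J p (sample_then_run A J p s ps seq)
      \<le> total_completion J p (A J p s) + real (card J) * sum p (sampled_jobs ps)"
proof -
  let ?K = "J - sampled_jobs ps"
  have J: "set seq \<union> ?K = J" using sub seq by auto
  have v: "valid_schedule ?K p (A ?K p s)"
    using A(1) p fin unfolding scheduling_algorithm_def by blast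
  show "valid_schedule J p (sample_then_run A J p s ps seq)"
    using valid_run_first[OF _ v seq(1)] J fin p seq sub
    by (fastforce simp: sample_then_run_def intro: less_imp_le)
  have "total_completion J p (sample_then_run A J p s ps seq)
      \<le> total_completion ?K p (A ?K p s) + real (card J) * sum p (sampled_jobs ps)"
    using total_completion_run_first_le[OF _ v seq(1)] fin p sub seq(2) unfolding sample_then_run_def
    by (metis Diff_disjoint J finite_Diff)
  also have "total_completion ?K p (A ?K p s) \<le> total_completion J p (A J p s)"
    using A fin p by (intro total_completion_computable_delays_mono) auto
  finally show "total_completion J p (sample_then_run A J p s ps seq)
      \<le> total_completion J p (A J p s) + real (card J) * sum p (sampled_jobs ps)" by simp
qed

lemma card_sampled_jobs: "card (sampled_jobs ps) \<le> 2 * length ps"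
proof -
  have "card (sampled_jobs ps) \<le> card (fst ` set ps) + card (snd ` set ps)"
    unfolding sampled_jobs_def by (rule card_Un_le)
  also have "\<dots> \<le> length ps + length ps"
    by (metis add_mono card_length length_map list.set_map)
  finally show ?thesis by simp
qed

text \<open>
  Here \<open>a = n powr (1/3)\<close> and \<open>l = (ln g) powr (1/3)\<close>, so that the prescribed sample size is
  \<open>a\<^sup>2 * l / 8\<close>; the bounds on \<open>m\<close> leave a factor 2 for rounding. The choice \<open>t = 8 * l / (a * P)\<close>
  balances the two terms of \<open>expectation_empirical_minimizer\<close> up to constants.
\<close>

lemma sample_size_tradeoff:
  fixes a l P M m :: real
  assumes "0 < a" "0 < l" "0 < P" "0 \<le> M" "M \<le> a ^ 6"
    and m: "a\<^sup>2 * l / 16 \<le> m" "m \<le> a\<^sup>2 * l / 4"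
  defines "t \<equiv> 8 * l / (a * P)"
  shows "M / 2 * (l ^ 3 / (m * t) + t * P\<^sup>2 / 8) + 2 * m * a ^ 3 * P \<le> 9/4 * a ^ 5 * l * P"
proof -
  have pos: "0 < a\<^sup>2 * l / 16" "0 < t" using assms(1-3) by (simp_all add: t_def)
  then have "0 < m" using m(1) by linarith
  have "l ^ 3 / (m * t) \<le> l ^ 3 / (a\<^sup>2 * l / 16 * t)"
    using assms pos \<open>0 < m\<close> by (intro divide_left_mono mult_right_mono mult_pos_pos) auto
  \<comment> \<open>The lower bound on \<open>m\<close> has entered through the estimation error;
    the upper bound serves the cost of the sampled jobs below.\<close>
  also have "\<dots> = 2 * (l * P / a)"
    using assms(1-3) by (simp add: t_def field_simps power2_eq_square power3_eq_cube)
  finally have "l ^ 3 / (m * t) + t * P\<^sup>2 / 8 \<le> 2 * (l * P / a) + t * P\<^sup>2 / 8"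
    by simp
  also have "\<dots> = 3 * (l * P / a)"
    using assms(1-3) by (simp add: t_def power2_eq_square)
  finally have "l ^ 3 / (m * t) + t * P\<^sup>2 / 8 \<le> 3 * (l * P / a)" .
  then have "M / 2 * (l ^ 3 / (m * t) + t * P\<^sup>2 / 8) \<le> a ^ 6 / 2 * (3 * (l * P / a))"
    using assms pos \<open>0 < m\<close> by (intro mult_mono) auto
  also have "\<dots> = 3/2 * a ^ 5 * l * P"
    using \<open>0 < a\<close> by (simp add: eval_nat_numeral)
  finally have 1: "M / 2 * (l ^ 3 / (m * t) + t * P\<^sup>2 / 8) \<le> 3/2 * a ^ 5 * l * P" .
  have "2 * m * a ^ 3 * P \<le> 2 * (a\<^sup>2 * l / 4) * a ^ 3 * P"
    using assms by (intro mult_right_mono mult_left_mono) auto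
  also have "\<dots> = 1/2 * a ^ 5 * l * P"
    by (simp add: eval_nat_numeral)
  finally have 2: "2 * m * a ^ 3 * P \<le> 1/2 * a ^ 5 * l * P" .
  have "M / 2 * (l ^ 3 / (m * t) + t * P\<^sup>2 / 8) + 2 * m * a ^ 3 * P
      \<le> 3/2 * a ^ 5 * l * P + 1/2 * a ^ 5 * l * P"
    using 1 2 by (rule add_mono)
  \<comment> \<open>Estimation takes 3/2 and sampling 1/2; the constant 9/4 is used up only by the
    theorem's case of few jobs.\<close>
  also have "\<dots> = 2 * (a ^ 5 * l * P)" by simp
  also have "\<dots> \<le> 9/4 * (a ^ 5 * l * P)"
    using assms(1-3) by (intro mult_right_mono) auto
  also have "\<dots> = 9/4 * a ^ 5 * l * P" by simp
  finally show ?thesis .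
qed

text \<open>The assumptions force \<open>a\<^sup>2 * l / 8\<close> to be at least 1, and from 1 on
  rounding either way changes a number by at most a factor 2.\<close>

lemma sample_size_rounding:
  fixes a l :: real
  assumes "0 < l" "9/2 * l < a" "2/3 \<le> l ^ 3"
    and m: "m = nat \<lfloor>1/8 * a\<^sup>2 * l\<rfloor> \<or> m = nat \<lceil>1/8 * a\<^sup>2 * l\<rceil>"
  shows "a\<^sup>2 * l / 16 \<le> real m" and "real m \<le> a\<^sup>2 * l / 4"
proof -
  define x where "x = 1/8 * a\<^sup>2 * l"
  have "(9/2 * l)\<^sup>2 * l \<le> a\<^sup>2 * l"
    using assms by (intro mult_right_mono power_mono) auto
  then have "8 \<le> a\<^sup>2 * l"
    using assms(3) by (simp add: power2_eq_square power3_eq_cube)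
  then have x: "1 \<le> x" and eqs: "a\<^sup>2 * l / 16 = x / 2" "a\<^sup>2 * l / 4 = 2 * x"
    by (simp_all add: x_def)
  \<comment> \<open>For the floor, adding \<open>x - 1 \<le> m\<close> and \<open>1 \<le> m\<close>
    yields \<open>x / 2 \<le> m\<close>.\<close>
  have "x - 1 \<le> real m \<and> x / 2 \<le> real m \<and> real m \<le> x + 1"
    using m unfolding x_def[symmetric]
  proof
    assume "m = nat \<lfloor>x\<rfloor>"
    moreover have "1 \<le> \<lfloor>x\<rfloor>" using x by simp
    ultimately have "real m = of_int \<lfloor>x\<rfloor>" "1 \<le> real m" by simp_all
    then show ?thesis by linarith
  next
    assume "m = nat \<lceil>x\<rceil>"
    then have "real m = of_int \<lceil>x\<rceil>" using x by simp
    then show ?thesis using x by linarith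
  qed
  then show "a\<^sup>2 * l / 16 \<le> real m" and "real m \<le> a\<^sup>2 * l / 4"
    unfolding eqs using x by linarith+
qed

section \<open>Expected total completion time of the sampling algorithm\<close>

theorem theorem4:
  fixes J :: "'a set" and p :: "'a \<Rightarrow> real" and s :: "'a \<Rightarrow> 'b"
    and n g m :: nat
    and A :: "nat \<Rightarrow> ('a, 'b) algorithm"
    and seq :: "('a \<times> 'a) list \<Rightarrow> 'a list"
    and hsel :: "('a \<times> 'a) list \<Rightarrow> nat"
  assumes "finite J" and "card J = n" and "n \<ge> 2"
    and "\<And>j. j \<in> J \<Longrightarrow> p j > 0"
    and "g \<ge> 1"
    and "\<And>h. h \<in> {1..g} \<Longrightarrow> scheduling_algorithm (A h)"
    and "\<And>h. h \<in> {1..g} \<Longrightarrow> computable_delays (A h)"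
    and "m = nat \<lfloor>1/8 * real n powr (2/3) * ln (real g) powr (1/3)\<rfloor> \<or>
         m = nat \<lceil>1/8 * real n powr (2/3) * ln (real g) powr (1/3)\<rceil>"
    and "\<And>ps. ps \<in> set_pmf (sample_pairs m J) \<Longrightarrow>
           distinct (seq ps) \<and> set (seq ps) = sampled_jobs ps"
    and "\<And>ps. ps \<in> set_pmf (sample_pairs m J) \<Longrightarrow>
           is_arg_min (\<lambda>h. sampled_delay (A h) J p s ps) (\<lambda>h. h \<in> {1..g}) (hsel ps)"
  shows "measure_pmf.expectation (sample_pairs m J)
           (\<lambda>ps. total_completion J p (sample_then_run (A (hsel ps)) J p s ps (seq ps)))
         \<le> (MIN h\<in>{1..g}. total_completion J p (A h J p s))
           + 9/4 * real n powr (5/3) * ln (real g) powr (1/3) * (MAX i\<in>J. p i)"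
proof -
  note fin = assms(1)
  define P where "P = (MAX i\<in>J. p i)"
  define a where "a = real n powr (1/3)"
  define l where "l = ln (real g) powr (1/3)"
  define q where "q = pmf_of_set (distinct_pairs J)"
  define M where "M = card (distinct_pairs J)"
  define TC where "TC h = total_completion J p (A h J p s)" for h
  define ALG where
    "ALG ps = total_completion J p (sample_then_run (A (hsel ps)) J p s ps (seq ps))" for ps
  let ?Q = "replicate_pmf m q"

  have a: "a > 0" using \<open>n \<ge> 2\<close> by (simp add: a_def)
  have powers: "real n powr (2/3) = a\<^sup>2" "real n powr (5/3) = a ^ 5" "real n = a ^ 3"
    using \<open>n \<ge> 2\<close> by (simp_all add: a_def powr_powr flip: powr_realpow)
  \<comment> \<open>For \<open>g = 1\<close> the base \<open>ln g\<close> is 0, and writing the cube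
    as a \<open>powr\<close> requires a positive base.\<close>
  have L: "ln (real g) = l ^ 3" and "l \<ge> 0"
    using \<open>g \<ge> 1\<close> by (cases "g = 1"; simp add: l_def powr_powr flip: powr_realpow)+
  have M: "M = n * (n - 1)"
    using card_distinct_pairs[OF fin] \<open>card J = n\<close> by (simp add: M_def)
  have "real M \<le> real n * real n"
    by (simp add: M mult_left_mono)
  also have "\<dots> = a ^ 6" by (simp add: powers eval_nat_numeral)
  finally have M_le: "real M \<le> a ^ 6" .
  have M_pos: "M > 0" using M \<open>n \<ge> 2\<close> by simp
  then have ne: "distinct_pairs J \<noteq> {}" by (auto simp: M_def)
  note finD = finite_distinct_pairs[OF fin]
  have set_q: "set_pmf q = distinct_pairs J" using ne finD by (simp add: q_def)
  then have finq: "finite (set_pmf q)" using finD by simp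
  have Q: "sample_pairs m J = ?Q" by (simp add: sample_pairs_def q_def)
  have finQ: "finite (set_pmf ?Q)"
    by (rule finite_set_replicate_pmf[OF finq])
  note [simp] = integrable_measure_pmf_finite[OF finQ]
  have p_le: "p j \<le> P" if "j \<in> J" for j
    using that fin by (simp add: P_def)
  have P: "P > 0"
  proof -
    obtain j where "j \<in> J" using \<open>card J = n\<close> \<open>n \<ge> 2\<close> by fastforce
    then show ?thesis using p_le[of j] assms(4)[of j] by simp
  qed
  obtain h0 where h0: "h0 \<in> {1..g}" "(MIN h\<in>{1..g}. TC h) = TC h0"
  proof -
    have "(MIN h\<in>{1..g}. TC h) \<in> TC ` {1..g}"
      using \<open>g \<ge> 1\<close> by (intro Min_in) auto
    then show ?thesis using that by auto
  qed
  have valid: "valid_schedule J p (A h J p s)" if "h \<in> {1..g}" for h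
    using assms(6)[OF that] fin assms(4) by (simp add: scheduling_algorithm_def)

  have sel: "hsel ps \<in> {1..g}"
    and ALG_valid: "valid_schedule J p (sample_then_run (A (hsel ps)) J p s ps (seq ps))"
    and ALG_le: "ALG ps \<le> TC (hsel ps) + 2 * real m * real n * P"
    if ps: "ps \<in> set_pmf ?Q" for ps
  proof -
    show h: "hsel ps \<in> {1..g}" using assms(10)[of ps] ps by (simp add: Q is_arg_min_def)
    have ps': "set ps \<subseteq> distinct_pairs J" "length ps = m"
      using ps by (auto simp: set_replicate_pmf set_q)
    then have sub: "sampled_jobs ps \<subseteq> J" by (auto simp: sampled_jobs_def distinct_pairs_def)
    note order = assms(9)[of ps, unfolded Q, OF ps]
    note run = sample_then_run_properties[where p = p and s = s, OF assms(6)[OF h] assms(7)[OF h]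
      fin assms(4) sub conjunct1[OF order] conjunct2[OF order]]
    show "valid_schedule J p (sample_then_run (A (hsel ps)) J p s ps (seq ps))"
      using run(1) by blast
    have "sum p (sampled_jobs ps) \<le> real (card (sampled_jobs ps)) * P"
      using sub p_le by (intro sum_bounded_above) auto
    also have "\<dots> \<le> (2 * real m) * P"
      using card_sampled_jobs[of ps] ps' P by (intro mult_right_mono) auto
    finally have "real n * sum p (sampled_jobs ps) \<le> real n * ((2 * real m) * P)"
      by (intro mult_left_mono) auto
    then show "ALG ps \<le> TC (hsel ps) + 2 * real m * real n * P"
      using run(2) \<open>card J = n\<close> by (simp add: ALG_def TC_def mult_ac)
  qed

  have "measure_pmf.expectation ?Q ALG \<le> TC h0 + 9/4 * a ^ 5 * l * P"
  proof -
    \<comment> \<open>Any two schedules differ by at most \<open>a ^ 6 * P / 2\<close>, which is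
      within the claimed error as long as \<open>a \<le> 9/2 * l\<close>. Beyond this threshold the
      sample is large enough for rounding to be harmless.\<close>
    consider "g = 1" | "a \<le> 9/2 * l" | "g \<ge> 2" "9/2 * l < a" using \<open>g \<ge> 1\<close> by linarith
    then show ?thesis
    proof cases
      case 1
      \<comment> \<open>The sample is empty and there is a single algorithm, so nothing is
        lost.\<close>
      then have "l = 0" "m = 0" using assms(8) by (auto simp: l_def)
      have "ALG ps \<le> TC h0" if "ps \<in> set_pmf ?Q" for ps
        using sel[OF that] ALG_le[OF that] h0(1) \<open>m = 0\<close> \<open>g = 1\<close> by simp
      then have "measure_pmf.expectation ?Q ALG \<le> measure_pmf.expectation ?Q (\<lambda>_. TC h0)"
        by (intro expectation_pmf_mono[OF finQ])
      then show ?thesis using \<open>l = 0\<close> by simp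
    next
      case 2
      have "real M * P / 2 \<le> a ^ 6 * P / 2"
        using M_le P by simp
      also have "\<dots> = a ^ 5 * P / 2 * a" by (simp add: eval_nat_numeral)
      also have "\<dots> \<le> a ^ 5 * P / 2 * (9/2 * l)"
        using 2 a P by (intro mult_left_mono) auto
      finally have "real M * P / 2 \<le> 9/4 * a ^ 5 * l * P" by (simp add: mult_ac)
      then have "ALG ps \<le> TC h0 + 9/4 * a ^ 5 * l * P" if "ps \<in> set_pmf ?Q" for ps
        using total_completion_le_other_schedule[OF fin ALG_valid[OF that] valid[OF h0(1)] p_le]
        unfolding ALG_def[symmetric] TC_def[symmetric] M_def[symmetric] by linarith
      then have "measure_pmf.expectation ?Q ALG
          \<le> measure_pmf.expectation ?Q (\<lambda>_. TC h0 + 9/4 * a ^ 5 * l * P)"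
        by (intro expectation_pmf_mono[OF finQ])
      then show ?thesis by simp
    next
      case 3
      have "ln 2 \<le> ln (real g)" using \<open>g \<ge> 2\<close> by simp
      then have l3: "2/3 \<le> l ^ 3" using ln2_ge_two_thirds L by linarith
      then have "l > 0" using \<open>l \<ge> 0\<close> by (cases "l = 0") auto
      have m: "a\<^sup>2 * l / 16 \<le> real m" "real m \<le> a\<^sup>2 * l / 4"
        using sample_size_rounding[OF \<open>l > 0\<close> 3(2) l3] assms(8)[folded l_def, unfolded powers(1)]
        by blast+
      moreover have "0 < a\<^sup>2 * l / 16" using a \<open>l > 0\<close> by simp
      ultimately have "m > 0" by (cases "m = 0") auto
      define D where "D h = (\<lambda>(u, v). delay p (A h J p s) u v + delay p (A h J p s) v u)" for h
      \<comment> \<open>Subtracting \<open>b\<close> does not affect the minimizer, but makes the range of the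
        summands \<open>P\<close> wide instead of \<open>2 * P\<close>.\<close>
      define b where "b = (\<lambda>(u, v). min (p u) (p v))"
      define f where "f h x = D h x - b x" for h x
      define t where "t = 8 * l / (a * P)"
      \<comment> \<open>The part of the total completion time that is the same for all
        \<open>h\<close>; it includes the subtracted \<open>b\<close>.\<close>
      define c where "c = sum p J + sum b (distinct_pairs J) / 2"
      have t: "t > 0" using a P \<open>l > 0\<close> by (simp add: t_def)
      have TC_eq: "TC h = c + real M / 2 * measure_pmf.expectation q (f h)" if "h \<in> {1..g}" for h
      proof -
        have "real M * measure_pmf.expectation q (f h)
            = sum (D h) (distinct_pairs J) - sum b (distinct_pairs J)"
          using M_pos ne finD by (simp add: q_def integral_pmf_of_set f_def sum_subtractf M_def)
        moreover have "TC h = sum p J + sum (D h) (distinct_pairs J) / 2"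
          unfolding TC_def D_def total_completion_eq_pair_delays[OF fin valid[OF that]] ..
        ultimately show ?thesis by (simp add: c_def field_simps)
      qed
      have f_bounds: "0 \<le> f h x \<and> f h x \<le> P" if h: "h \<in> {1..g}" and xq: "x \<in> set_pmf q" for h x
      proof -
        obtain u v where x: "x = (u, v)" "u \<in> J" "v \<in> J"
          using xq by (auto simp: set_q distinct_pairs_def)
        show ?thesis
          using pair_delay_bounds[OF fin valid[OF h] x(2,3)] p_le[OF x(2)] p_le[OF x(3)]
          by (auto simp: f_def D_def b_def x(1))
      qed
      have erm: "sum_list (map (f (hsel ps)) ps) \<le> sum_list (map (f h0) ps)"
        if "ps \<in> set_pmf ?Q" for ps
      proof -
        have "sampled_delay (A h) J p s ps = sum_list (map (D h) ps)" for h
          unfolding sampled_delay_def D_def ..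
        then have "sum_list (map (D (hsel ps)) ps) \<le> sum_list (map (D h0) ps)"
          using assms(10)[of ps] that h0(1) by (simp add: Q is_arg_min_linorder)
        moreover have "sum_list (map (f h) ps) = sum_list (map (D h) ps) - sum_list (map b ps)" for h
          unfolding f_def by (rule sum_list_subtractf)
        ultimately show ?thesis by simp
      qed
      \<comment> \<open>For a given sample, the pair delays of the selected algorithm are expressed
        by its mean loss on a fresh pair.\<close>
      have "measure_pmf.expectation ?Q ALG
          \<le> measure_pmf.expectation ?Q (\<lambda>ps. c
              + real M / 2 * measure_pmf.expectation q (f (hsel ps)) + 2 * real m * real n * P)"
        using ALG_le sel TC_eq by (intro expectation_pmf_mono[OF finQ]) fastforce
      also have "\<dots> = c + real M / 2
            * measure_pmf.expectation ?Q (\<lambda>ps. measure_pmf.expectation q (f (hsel ps)))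
            + 2 * real m * real n * P"
        by simp
      also have "\<dots> \<le> c + real M / 2 * (measure_pmf.expectation q (f h0)
            + ln (card {1..g}) / (m * t) + t * P\<^sup>2 / 8) + 2 * real m * real n * P"
        using expectation_empirical_minimizer[OF finq _ t \<open>m > 0\<close> f_bounds sel erm]
        by (intro add_mono mult_left_mono order_refl) auto
      also have "\<dots> = TC h0 + (real M / 2 * (l ^ 3 / (m * t) + t * P\<^sup>2 / 8) + 2 * m * a ^ 3 * P)"
        unfolding TC_eq[OF h0(1)] using powers(3) by (simp add: L algebra_simps)
      also have "\<dots> \<le> TC h0 + 9/4 * a ^ 5 * l * P"
        using sample_size_tradeoff[OF a \<open>l > 0\<close> P _ M_le m] by (simp add: t_def)
      finally show ?thesis .
    qed
  qed
  then show ?thesis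
    unfolding Q powers(2) P_def[symmetric] l_def[symmetric] ALG_def TC_def[symmetric] h0(2) .
qed

end
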